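(* If $L$ is a Latin square, then $b_L(H^L)=\mathrm{scc}(L)+1$.
   Context: A Latin square $L$ of order $n$ is identified with its set of entries $(r,c,s)$ (symbol $s$ in row $r$, column $c$). A line of $L$ is a row, a column, or a symbol (equivalently the set of entries in it). The hypergraph $H^L$ has vertex set the $3n$ lines of $L$ and, for each entry $(r,c,s)$, a hyperedge $\{r,c,s\}$. Lazy burning: a set $M$ of vertices is burned in the first round; in each subsequent round, every unburned vertex lying in a hyperedge all of whose other vertices were burned by the end of the previous round becomes burned; nothing else is chosen. $M$ is a lazy burning set if eventually all vertices burn; $b_L(H)$ is the minimum size of a lazy burning set. A subsquare of $L$ is a subset of the entries that is itself a Latin square; it intersects a line $\ell$ if it contains an entry of $\ell$. A chain of $L$ is a sequence of subsquares $\emptyset=S_0\subseteq S_1\subseteq\cdots\subseteq S_\alpha=L$ with $S_1$ a single entry. It is connected if for each $1\le i\le\alpha$ there is a line $\ell$ intersecting $S_i$ but not $S_{i-1}$ such that $S_i$ is the smallest subsquare of $L$ intersecting $\ell$ and containing all entries of $S_{i-1}$. Its length is $\alpha$; $\mathrm{scc}(L)$ is the minimum length of a connected chain of $L$. *)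

theory Defs
  imports Main
begin

type_synonym ('r, 'c, 's) square = "('r \<times> 'c \<times> 's) set"

definition row_set :: "('r, 'c, 's) square \<Rightarrow> 'r set" where
  "row_set L = {r. \<exists>c s. (r, c, s) \<in> L}"

definition col_set :: "('r, 'c, 's) square \<Rightarrow> 'c set" where
  "col_set L = {c. \<exists>r s. (r, c, s) \<in> L}"

definition sym_set :: "('r, 'c, 's) square \<Rightarrow> 's set" where
  "sym_set L = {s. \<exists>r c. (r, c, s) \<in> L}"

text \<open>
  A square is its set of entries (row, column, symbol), and its rows, columns and symbols are
  those that occur in an entry. Order 0 is allowed: it makes the empty set a subsquare, as the
  first member of a chain requires.
\<close>
definition latin_square :: "nat \<Rightarrow> ('r, 'c, 's) square \<Rightarrow> bool" where
  "latin_square n L \<longleftrightarrow>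
     finite L \<and> card (row_set L) = n \<and> card (col_set L) = n \<and> card (sym_set L) = n \<and>
     (\<forall>r\<in>row_set L. \<forall>c\<in>col_set L. \<exists>!s. (r, c, s) \<in> L) \<and>
     (\<forall>r\<in>row_set L. \<forall>s\<in>sym_set L. \<exists>!c. (r, c, s) \<in> L) \<and>
     (\<forall>c\<in>col_set L. \<forall>s\<in>sym_set L. \<exists>!r. (r, c, s) \<in> L)"

definition subsquare :: "('r, 'c, 's) square \<Rightarrow> ('r, 'c, 's) square \<Rightarrow> bool" where
  "subsquare T L \<longleftrightarrow> T \<subseteq> L \<and> (\<exists>m. latin_square m T)"

datatype ('r, 'c, 's) line = Row 'r | Col 'c | Sym 's

definition lines :: "('r, 'c, 's) square \<Rightarrow> ('r, 'c, 's) line set" where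
  "lines L = Row ` row_set L \<union> Col ` col_set L \<union> Sym ` sym_set L"

fun line_entries :: "('r, 'c, 's) square \<Rightarrow> ('r, 'c, 's) line \<Rightarrow> ('r \<times> 'c \<times> 's) set" where
  "line_entries L (Row x) = {(r, c, s). (r, c, s) \<in> L \<and> r = x}"
| "line_entries L (Col x) = {(r, c, s). (r, c, s) \<in> L \<and> c = x}"
| "line_entries L (Sym x) = {(r, c, s). (r, c, s) \<in> L \<and> s = x}"

definition intersects ::
    "('r, 'c, 's) square \<Rightarrow> ('r, 'c, 's) square \<Rightarrow> ('r, 'c, 's) line \<Rightarrow> bool" where
  "intersects L T l \<longleftrightarrow> T \<inter> line_entries L l \<noteq> {}"

definition chain :: "('r, 'c, 's) square \<Rightarrow> (nat \<Rightarrow> ('r, 'c, 's) square) \<Rightarrow> nat \<Rightarrow> bool" where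
  "chain L S a \<longleftrightarrow>
     1 \<le> a \<and> S 0 = {} \<and> (\<exists>e. S 1 = {e}) \<and> S a = L \<and>
     (\<forall>i\<le>a. subsquare (S i) L) \<and> (\<forall>i<a. S i \<subseteq> S (Suc i))"

text \<open>
  ``Smallest'' means having the fewest entries. For \<open>i = 1\<close> no inclusion-least subsquare need
  exist, since every entry of \<open>l\<close> is a subsquare meeting \<open>l\<close>. For \<open>i > 1\<close> the subsquares that
  meet \<open>l\<close> and contain \<open>S (i - 1)\<close> are closed under intersection, so the one with the fewest
  entries is also the least one under inclusion.
\<close>
definition connected_chain ::
    "('r, 'c, 's) square \<Rightarrow> (nat \<Rightarrow> ('r, 'c, 's) square) \<Rightarrow> nat \<Rightarrow> bool" where
  "connected_chain L S a \<longleftrightarrow>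
     chain L S a \<and>
     (\<forall>i\<in>{1..a}. \<exists>l\<in>lines L.
        intersects L (S i) l \<and> \<not> intersects L (S (i - 1)) l \<and>
        is_arg_min card (\<lambda>T. subsquare T L \<and> intersects L T l \<and> S (i - 1) \<subseteq> T) (S i))"

definition scc :: "('r, 'c, 's) square \<Rightarrow> nat" where
  "scc L = (LEAST a. \<exists>S. connected_chain L S a)"

type_synonym 'v hypergraph = "'v set \<times> 'v set set"

primrec lazy_burned :: "'v hypergraph \<Rightarrow> 'v set \<Rightarrow> nat \<Rightarrow> 'v set" where
  "lazy_burned H M 0 = M"
| "lazy_burned H M (Suc t) =
     lazy_burned H M t \<union>
     {v \<in> fst H. \<exists>e\<in>snd H. v \<in> e \<and> e - {v} \<subseteq> lazy_burned H M t}"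

definition lazy_burning_set :: "'v hypergraph \<Rightarrow> 'v set \<Rightarrow> bool" where
  "lazy_burning_set H M \<longleftrightarrow> M \<subseteq> fst H \<and> (\<exists>t. lazy_burned H M t = fst H)"

definition lazy_burning_number :: "'v hypergraph \<Rightarrow> nat" where
  "lazy_burning_number H = (LEAST k. \<exists>M. finite M \<and> lazy_burning_set H M \<and> card M = k)"

definition latin_hypergraph :: "('r, 'c, 's) square \<Rightarrow> ('r, 'c, 's) line hypergraph" where
  "latin_hypergraph L = (lines L, {{Row r, Col c, Sym s} |r c s. (r, c, s) \<in> L})"

end

theory Submission
  imports Defs
begin

text \<open>
  Call a set of lines closed if it contains the third line of an entry as soon as it contains
  two of them; a set burns everything iff no proper closed set contains it. Closed sets with an
  entry are exactly the line sets of nonempty subsquares, so the fire started by two lines of an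
  entry and then by one further line at a time runs through the members of a connected chain.
  Conversely, a burning set contains two lines of different kinds, hence two lines of some entry,
  and adding its other lines one by one, skipping those that are already met, gives a connected
  chain.
\<close>

section \<open>Lines, entries and closed sets\<close>

definition closed_lines :: "('r, 'c, 's) square \<Rightarrow> ('r, 'c, 's) line set \<Rightarrow> bool" where
  "closed_lines L X \<longleftrightarrow> X \<subseteq> lines L \<and>
     (\<forall>r c s. (r, c, s) \<in> L \<longrightarrow>
        (Row r \<in> X \<and> Col c \<in> X \<longrightarrow> Sym s \<in> X) \<and>
        (Row r \<in> X \<and> Sym s \<in> X \<longrightarrow> Col c \<in> X) \<and>
        (Col c \<in> X \<and> Sym s \<in> X \<longrightarrow> Row r \<in> X))"

text \<open>Inverse of \<open>lines\<close>: the two maps match the nonempty subsquares with the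
  closed sets that contain all three lines of some entry.\<close>

definition entries_in :: "('r, 'c, 's) square \<Rightarrow> ('r, 'c, 's) line set \<Rightarrow> ('r, 'c, 's) square" where
  "entries_in L X = {(r, c, s). (r, c, s) \<in> L \<and> Row r \<in> X \<and> Col c \<in> X \<and> Sym s \<in> X}"

text \<open>One link of a connected chain, with \<open>intersects\<close> replaced by membership in
  \<open>lines\<close>. As a binary relation it can be iterated with \<open>^^\<close>.\<close>

definition chain_step ::
    "('r, 'c, 's) square \<Rightarrow> ('r, 'c, 's) square \<Rightarrow> ('r, 'c, 's) square \<Rightarrow> bool" where
  "chain_step L T T' \<longleftrightarrow> (\<exists>l\<in>lines L. l \<in> lines T' \<and> l \<notin> lines T \<and>
     is_arg_min card (\<lambda>U. subsquare U L \<and> l \<in> lines U \<and> T \<subseteq> U) T')"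

lemma Row_in_lines [simp]: "Row r \<in> lines T \<longleftrightarrow> r \<in> row_set T"
  and Col_in_lines [simp]: "Col c \<in> lines T \<longleftrightarrow> c \<in> col_set T"
  and Sym_in_lines [simp]: "Sym s \<in> lines T \<longleftrightarrow> s \<in> sym_set T"
  by (auto simp: lines_def)

lemma lines_mono: "T \<subseteq> U \<Longrightarrow> lines T \<subseteq> lines U"
  by (fastforce simp: lines_def row_set_def col_set_def sym_set_def)

lemma entry_lines:
  assumes "(r, c, s) \<in> T"
  shows "r \<in> row_set T" "c \<in> col_set T" "s \<in> sym_set T"
  using assms by (auto simp: row_set_def col_set_def sym_set_def)

lemma lines_singleton: "lines {(r, c, s)} = {Row r, Col c, Sym s}"
  by (auto simp: lines_def row_set_def col_set_def sym_set_def)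

lemma finite_lines: "finite L \<Longrightarrow> finite (lines L)"
proof -
  assume "finite L"
  moreover have "row_set L = fst ` L" "col_set L = (fst \<circ> snd) ` L" "sym_set L = (snd \<circ> snd) ` L"
    by (force simp: row_set_def col_set_def sym_set_def)+
  ultimately show ?thesis by (simp add: lines_def)
qed

lemma intersects_iff_in_lines:
  assumes "T \<subseteq> L"
  shows "intersects L T l \<longleftrightarrow> l \<in> lines T"
  using assms by (cases l) (auto simp: intersects_def row_set_def col_set_def sym_set_def)

text \<open>Choosing partners gives a bijection. It serves to compare the numbers of rows, columns
  and symbols of a closed set, with \<open>P\<close> obtained from the entries on one fixed
  line.\<close>

lemma card_eq_if_unique_partners:
  assumes "\<And>a b. P a b \<Longrightarrow> a \<in> A \<and> b \<in> B"
    and "\<And>a. a \<in> A \<Longrightarrow> \<exists>!b. P a b" and "\<And>b. b \<in> B \<Longrightarrow> \<exists>!a. P a b"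
  shows "card A = card B"
proof -
  obtain f where f: "\<And>a. a \<in> A \<Longrightarrow> P a (f a)"
    using assms(2) by metis
  have "bij_betw f A B"
    using f assms by (intro bij_betwI') metis+
  then show ?thesis by (rule bij_betw_same_card)
qed

lemma entries_in_subset: "entries_in L X \<subseteq> L"
  by (auto simp: entries_in_def)

lemma closed_lines_Int: "closed_lines L X \<Longrightarrow> closed_lines L Y \<Longrightarrow> closed_lines L (X \<inter> Y)"
  unfolding closed_lines_def by blast

text \<open>The closure rule fires only on two lines of different kinds, so it never fires
  here.\<close>

lemma closed_lines_one_kind:
  assumes "X \<subseteq> lines L" and "X \<subseteq> range Row \<or> X \<subseteq> range Col \<or> X \<subseteq> range Sym"
  shows "closed_lines L X"
  using assms unfolding closed_lines_def by blast

lemma closed_lines_all: "closed_lines L (lines L)"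
  by (auto simp: closed_lines_def entry_lines)

lemma chain_stepD:
  assumes "chain_step L T T'"
  shows "subsquare T' L" and "T \<subseteq> T'"
  using assms by (auto simp: chain_step_def is_arg_min_def)

lemma lazy_burned_superset: "M \<subseteq> lazy_burned H M t"
  by (induction t) auto

text \<open>Induction on the rounds: if a hyperedge has all lines but \<open>v\<close> in
  \<open>Y\<close>, closure puts \<open>v\<close> into \<open>Y\<close> as well.\<close>

lemma lazy_burned_subset_closed:
  assumes "closed_lines L Y" and "M \<subseteq> Y"
  shows "lazy_burned (latin_hypergraph L) M t \<subseteq> Y"
proof (induction t)
  case 0
  then show ?case using assms by simp
next
  case (Suc t)
  have "v \<in> Y" if v: "v \<in> e" and edge: "e \<in> snd (latin_hypergraph L)"
      and burned: "e - {v} \<subseteq> lazy_burned (latin_hypergraph L) M t" for v e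
  proof -
    obtain r c s where e: "e = {Row r, Col c, Sym s}" "(r, c, s) \<in> L"
      using edge by (auto simp: latin_hypergraph_def)
    have closed: "Row r \<in> Y \<Longrightarrow> Col c \<in> Y \<Longrightarrow> Sym s \<in> Y" "Row r \<in> Y \<Longrightarrow> Sym s \<in> Y \<Longrightarrow> Col c \<in> Y"
        "Col c \<in> Y \<Longrightarrow> Sym s \<in> Y \<Longrightarrow> Row r \<in> Y"
      using assms(1) e(2) unfolding closed_lines_def by blast+
    have "e - {v} \<subseteq> Y" using burned Suc by (rule subset_trans)
    moreover have "v = Row r \<or> v = Col c \<or> v = Sym s"
      using v e(1) by simp
    ultimately show ?thesis
      unfolding e(1) by (elim disjE) (simp_all add: closed insert_Diff_if)
  qed
  then show ?case
    using Suc unfolding lazy_burned.simps by (intro Un_least subsetI) auto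
qed

section \<open>Subsquares as closed sets of lines\<close>

context
  fixes L :: "('r, 'c, 's) square" and n :: nat
  assumes latin: "latin_square n L"
begin

lemma finite_square: "finite L"
  using latin by (simp add: latin_square_def)

lemma unique_entry:
  shows "r \<in> row_set L \<Longrightarrow> c \<in> col_set L \<Longrightarrow> \<exists>!s. (r, c, s) \<in> L"
    and "r \<in> row_set L \<Longrightarrow> s \<in> sym_set L \<Longrightarrow> \<exists>!c. (r, c, s) \<in> L"
    and "c \<in> col_set L \<Longrightarrow> s \<in> sym_set L \<Longrightarrow> \<exists>!r. (r, c, s) \<in> L"
  using latin by (auto simp: latin_square_def)

lemma subsquare_self: "subsquare L L"
  using latin by (auto simp: subsquare_def)

text \<open>Two lines of \<open>T\<close> of different kinds share an entry of \<open>T\<close>; by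
  uniqueness in \<open>L\<close> it is their only common entry in \<open>L\<close>, so its third
  line belongs to \<open>T\<close>.\<close>

lemma subsquare_closed_lines:
  assumes "subsquare T L"
  shows "closed_lines L (lines T)"
proof -
  obtain m where T: "T \<subseteq> L" "latin_square m T"
    using assms by (auto simp: subsquare_def)
  have "s \<in> sym_set T" if "(r, c, s) \<in> L" "r \<in> row_set T" "c \<in> col_set T" for r c s
    using T that unique_entry(1)[of r c] entry_lines[of r c _ L] entry_lines[of r c _ T]
    unfolding latin_square_def by (metis subsetD)
  moreover have "c \<in> col_set T" if "(r, c, s) \<in> L" "r \<in> row_set T" "s \<in> sym_set T" for r c s
    using T that unique_entry(2)[of r s] entry_lines[of r _ s L] entry_lines[of r _ s T]
    unfolding latin_square_def by (metis subsetD)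
  moreover have "r \<in> row_set T" if "(r, c, s) \<in> L" "c \<in> col_set T" "s \<in> sym_set T" for r c s
    using T that unique_entry(3)[of c s] entry_lines[of _ c s L] entry_lines[of _ c s T]
    unfolding latin_square_def by (metis subsetD)
  ultimately show ?thesis
    using lines_mono[OF T(1)] by (simp add: closed_lines_def)
qed

lemma entries_in_lines_subsquare:
  assumes "subsquare T L"
  shows "entries_in L (lines T) = T"
proof -
  obtain m where T: "T \<subseteq> L" "latin_square m T"
    using assms by (auto simp: subsquare_def)
  have "(r, c, s) \<in> T" if "(r, c, s) \<in> L" "r \<in> row_set T" "c \<in> col_set T" for r c s
    using T that unique_entry(1)[of r c] entry_lines[of r c s L]
    unfolding latin_square_def by (metis subsetD)
  then show ?thesis
    using T(1) by (auto simp: entries_in_def entry_lines)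
qed

text \<open>Closure turns the uniqueness conditions of \<open>L\<close> into those of
  \<open>entries_in L X\<close>. The entry given by \<open>ne\<close> provides a line of each kind,
  which makes the three kinds equally numerous and puts every line of \<open>X\<close> on some
  entry.\<close>

lemma closed_lines_subsquare:
  assumes X: "closed_lines L X" and ne: "entries_in L X \<noteq> {}"
  shows "subsquare (entries_in L X) L" and "lines (entries_in L X) = X"
proof -
  let ?T = "entries_in L X"
  obtain r0 c0 s0 where e: "(r0, c0, s0) \<in> L" "Row r0 \<in> X" "Col c0 \<in> X" "Sym s0 \<in> X"
    using ne by (auto simp: entries_in_def)
  have XL: "r \<in> row_set L" if "Row r \<in> X" for r
    using X that unfolding closed_lines_def by (metis Row_in_lines subsetD)
  have XC: "c \<in> col_set L" if "Col c \<in> X" for c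
    using X that unfolding closed_lines_def by (metis Col_in_lines subsetD)
  have XS: "s \<in> sym_set L" if "Sym s \<in> X" for s
    using X that unfolding closed_lines_def by (metis Sym_in_lines subsetD)
  have closed: "Row r \<in> X \<Longrightarrow> Col c \<in> X \<Longrightarrow> Sym s \<in> X" "Row r \<in> X \<Longrightarrow> Sym s \<in> X \<Longrightarrow> Col c \<in> X"
      "Col c \<in> X \<Longrightarrow> Sym s \<in> X \<Longrightarrow> Row r \<in> X" if "(r, c, s) \<in> L" for r c s
    using X that unfolding closed_lines_def by blast+
  have rc: "\<exists>!s. (r, c, s) \<in> ?T" if "Row r \<in> X" "Col c \<in> X" for r c
  proof -
    have "(r, c, s) \<in> ?T \<longleftrightarrow> (r, c, s) \<in> L" for s
      using that closed by (auto simp: entries_in_def)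
    then show ?thesis using unique_entry(1)[OF XL XC, OF that] by simp
  qed
  have rs: "\<exists>!c. (r, c, s) \<in> ?T" if "Row r \<in> X" "Sym s \<in> X" for r s
  proof -
    have "(r, c, s) \<in> ?T \<longleftrightarrow> (r, c, s) \<in> L" for c
      using that closed by (auto simp: entries_in_def)
    then show ?thesis using unique_entry(2)[OF XL XS, OF that] by simp
  qed
  have cs: "\<exists>!r. (r, c, s) \<in> ?T" if "Col c \<in> X" "Sym s \<in> X" for c s
  proof -
    have "(r, c, s) \<in> ?T \<longleftrightarrow> (r, c, s) \<in> L" for r
      using that closed by (auto simp: entries_in_def)
    then show ?thesis using unique_entry(3)[OF XC XS, OF that] by simp
  qed
  \<comment> \<open>Each line of \<open>X\<close> meets a line of the fixed entry in an entry of
    \<open>?T\<close>: rows are met with \<open>c0\<close>, columns and symbols with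
    \<open>r0\<close>.\<close>
  have ents: "Row r \<in> X" "Col c \<in> X" "Sym s \<in> X" if "(r, c, s) \<in> ?T" for r c s
    using that by (simp_all add: entries_in_def)
  have row: "r \<in> row_set ?T \<longleftrightarrow> Row r \<in> X" for r
    unfolding row_set_def mem_Collect_eq using ents(1) ex1_implies_ex[OF rc[OF _ e(3)]] by blast
  have col: "c \<in> col_set ?T \<longleftrightarrow> Col c \<in> X" for c
    unfolding col_set_def mem_Collect_eq using ents(2) ex1_implies_ex[OF rc[OF e(2)]] by blast
  have sym: "s \<in> sym_set ?T \<longleftrightarrow> Sym s \<in> X" for s
    unfolding sym_set_def mem_Collect_eq using ents(3) ex1_implies_ex[OF rs[OF e(2)]] by blast
  have "l \<in> lines ?T \<longleftrightarrow> l \<in> X" for l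
    by (cases l) (simp_all add: row col sym)
  then show "lines ?T = X" by blast
  \<comment> \<open>The entries in column \<open>c0\<close> pair rows with symbols; those in row
    \<open>r0\<close>, below, pair columns with symbols.\<close>
  have "card (row_set ?T) = card (sym_set ?T)"
  proof (rule card_eq_if_unique_partners)
    show "r \<in> row_set ?T \<and> s \<in> sym_set ?T" if "(r, c0, s) \<in> ?T" for r s
      using entry_lines[OF that] by simp
  qed (simp_all add: row sym rc[OF _ e(3)] cs[OF e(3)])
  moreover have "card (col_set ?T) = card (sym_set ?T)"
  proof (rule card_eq_if_unique_partners)
    show "c \<in> col_set ?T \<and> s \<in> sym_set ?T" if "(r0, c, s) \<in> ?T" for c s
      using entry_lines[OF that] by simp
  qed (simp_all add: col sym rc[OF e(2)] rs[OF e(2)])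
  moreover have "finite ?T"
    using finite_square entries_in_subset by (rule rev_finite_subset)
  ultimately have "latin_square (card (sym_set ?T)) ?T"
    using rc rs cs unfolding latin_square_def by (simp add: row col sym)
  then show "subsquare ?T L"
    using entries_in_subset by (auto simp: subsquare_def)
qed

lemma subsquare_eq_if_lines_eq:
  "subsquare T L \<Longrightarrow> subsquare U L \<Longrightarrow> lines T = lines U \<Longrightarrow> T = U"
  by (metis entries_in_lines_subsquare)

lemma subsquare_singleton:
  assumes "e \<in> L"
  shows "subsquare {e} L"
proof -
  obtain r c s where e: "e = (r, c, s)" by (cases e)
  have "row_set {e} = {r}" "col_set {e} = {c}" "sym_set {e} = {s}"
    by (auto simp: e row_set_def col_set_def sym_set_def)
  then have "latin_square 1 {e}"
    by (auto simp: latin_square_def e)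
  then show ?thesis
    using assms by (auto simp: subsquare_def)
qed

section \<open>Steps of connected chains\<close>

lemma chain_step_exists:
  assumes "subsquare T L" and "l \<in> lines L" and "l \<notin> lines T"
  obtains T' where "chain_step L T T'" and "subsquare T' L" and "T \<subseteq> T'" and "l \<in> lines T'"
proof -
  let ?P = "\<lambda>U. subsquare U L \<and> l \<in> lines U \<and> T \<subseteq> U"
  have "?P L"
    using assms subsquare_self by (auto simp: subsquare_def)
  then obtain T' where T': "is_arg_min card ?P T'"
    by (metis (no_types, lifting) ex_has_least_nat is_arg_min_linorder)
  then have "?P T'" by (simp add: is_arg_min_def)
  with T' show ?thesis
    using assms by (intro that[of T']) (auto simp: chain_step_def)
qed

text \<open>The row of \<open>e\<close> serves as the new line: a subsquare that meets it has at
  least one entry, so a single entry attains the minimum of \<open>card\<close>.\<close>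

lemma chain_step_empty_singleton:
  assumes "e \<in> L"
  shows "chain_step L {} {e}"
proof -
  obtain r c s where e: "e = (r, c, s)" by (cases e)
  have "card {e} \<le> card U" if "subsquare U L" "Row r \<in> lines U" for U
  proof -
    have "finite U" "U \<noteq> {}"
      using that finite_square
      by (auto simp: subsquare_def row_set_def intro: rev_finite_subset)
    then show ?thesis by (simp add: Suc_leI card_gt_0_iff)
  qed
  then have "is_arg_min card (\<lambda>U. subsquare U L \<and> Row r \<in> lines U \<and> {} \<subseteq> U) {e}"
    using subsquare_singleton[OF assms] unfolding is_arg_min_linorder
    by (simp add: e lines_singleton del: Row_in_lines)
  moreover have "Row r \<in> lines L" "Row r \<in> lines {e}" "Row r \<notin> lines {}"
    using assms by (auto simp: e entry_lines row_set_def)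
  ultimately show ?thesis
    unfolding chain_step_def by blast
qed

text \<open>The subsquare and inclusion conditions of \<open>chain\<close> can be read off the
  steps, since each step leads to a subsquare that contains its source; only \<open>S 0 = {}\<close>
  is treated separately.\<close>

lemma connected_chain_iff:
  "connected_chain L S a \<longleftrightarrow> 1 \<le> a \<and> S 0 = {} \<and> (\<exists>e. S 1 = {e}) \<and> S a = L \<and>
     (\<forall>i<a. chain_step L (S i) (S (Suc i)))"
  (is "?lhs \<longleftrightarrow> ?rhs")
proof -
  have step_iff: "(\<exists>l\<in>lines L. intersects L (S (Suc i)) l \<and> \<not> intersects L (S i) l \<and>
        is_arg_min card (\<lambda>T. subsquare T L \<and> intersects L T l \<and> S i \<subseteq> T) (S (Suc i)))
      \<longleftrightarrow> chain_step L (S i) (S (Suc i))"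
    if "subsquare (S i) L" "subsquare (S (Suc i)) L" for i
  proof -
    have "(\<lambda>T. subsquare T L \<and> intersects L T l \<and> S i \<subseteq> T)
        = (\<lambda>T. subsquare T L \<and> l \<in> lines T \<and> S i \<subseteq> T)" for l
      using intersects_iff_in_lines by (fastforce simp: subsquare_def)
    then show ?thesis
      using that by (simp add: chain_step_def subsquare_def intersects_iff_in_lines)
  qed
  \<comment> \<open>Shifts the range \<open>{1..a}\<close> to \<open>i < a\<close>, so that
    \<open>i - 1\<close> and \<open>i\<close> become \<open>i\<close> and
    \<open>Suc i\<close>.\<close>
  have index: "(\<forall>i\<in>{1..a}. Q i (i - 1)) \<longleftrightarrow> (\<forall>i<a. Q (Suc i) i)" for Q :: "nat \<Rightarrow> nat \<Rightarrow> bool"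
  proof -
    have "{1..a} = Suc ` {..<a}"
      by (auto simp: image_iff gr0_conv_Suc Suc_le_eq)
    then show ?thesis by auto
  qed
  show ?thesis
  proof
    assume ?lhs
    then show ?rhs
      unfolding connected_chain_def chain_def
        index[where Q = "\<lambda>i j. \<exists>l\<in>lines L. intersects L (S i) l \<and> \<not> intersects L (S j) l \<and>
          is_arg_min card (\<lambda>T. subsquare T L \<and> intersects L T l \<and> S j \<subseteq> T) (S i)"]
      using step_iff by (meson Suc_leI less_imp_le_nat)
  next
    assume R: ?rhs
    have sub: "subsquare (S i) L" if "i \<le> a" for i
    proof (cases i)
      case 0
      have "latin_square 0 ({} :: ('r, 'c, 's) square)"
        by (auto simp: latin_square_def row_set_def col_set_def sym_set_def)
      then show ?thesis using R 0 by (auto simp: subsquare_def)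
    next
      case (Suc j)
      then show ?thesis using R that chain_stepD(1) Suc_le_eq by blast
    qed
    with R show ?lhs
      unfolding connected_chain_def chain_def
        index[where Q = "\<lambda>i j. \<exists>l\<in>lines L. intersects L (S i) l \<and> \<not> intersects L (S j) l \<and>
          is_arg_min card (\<lambda>T. subsquare T L \<and> intersects L T l \<and> S j \<subseteq> T) (S i)"]
      using step_iff chain_stepD(2) by (meson Suc_leI less_imp_le_nat)
  qed
qed

section \<open>Burning sets in terms of closed sets\<close>

text \<open>The burned sets grow inside the finite set \<open>lines L\<close>, so two consecutive
  ones agree, and a set unchanged by a round is closed.\<close>

lemma lazy_burned_eventually_closed:
  assumes "M \<subseteq> lines L"
  shows "\<exists>t. closed_lines L (lazy_burned (latin_hypergraph L) M t)"
proof -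
  let ?B = "lazy_burned (latin_hypergraph L) M"
  have sub: "?B t \<subseteq> lines L" for t
    using lazy_burned_subset_closed[OF closed_lines_all assms] .
  have fin: "finite (?B t)" for t
    using sub finite_lines[OF finite_square] by (rule finite_subset)
  have "\<exists>t. ?B (Suc t) = ?B t"
  proof (rule ccontr)
    assume "\<not> ?thesis"
    moreover have "?B t \<subseteq> ?B (Suc t)" for t
      by simp
    ultimately have "?B t \<subset> ?B (Suc t)" for t
      by blast
    then have lt: "card (?B t) < card (?B (Suc t))" for t
      using fin by (meson psubset_card_mono)
    \<comment> \<open>If every round burned a new line, at least \<open>t\<close> lines would be
      burned after \<open>t\<close> rounds, which is absurd once \<open>t\<close> exceeds the number
      of lines.\<close>
    have "t \<le> card (?B t)" for t
    proof (induction t)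
      case (Suc t)
      then show ?case using lt[of t] by linarith
    qed simp
    then have "Suc (card (lines L)) \<le> card (lines L)"
      using card_mono[OF finite_lines[OF finite_square] sub] by (rule le_trans)
    then show False by simp
  qed
  then obtain t where t: "?B (Suc t) = ?B t" ..
  have burn: "v \<in> ?B t" if "(r, c, s) \<in> L" "v \<in> {Row r, Col c, Sym s}"
      "{Row r, Col c, Sym s} - {v} \<subseteq> ?B t" for r c s v
  proof -
    have "v \<in> lines L" using that(2) entry_lines[OF that(1)] by auto
    moreover have "{Row r, Col c, Sym s} \<in> snd (latin_hypergraph L)"
      using that(1) unfolding latin_hypergraph_def snd_conv by blast
    ultimately have "v \<in> ?B (Suc t)"
      using that(2,3) unfolding lazy_burned.simps
      by (intro UnI2 CollectI conjI bexI) (simp_all add: latin_hypergraph_def)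
    then show ?thesis unfolding t .
  qed
  have "closed_lines L (?B t)"
    unfolding closed_lines_def
  proof (intro conjI allI impI sub)
    fix r c s assume "(r, c, s) \<in> L"
    note b = burn[OF this]
    show "Row r \<in> ?B t \<and> Col c \<in> ?B t \<Longrightarrow> Sym s \<in> ?B t"
      using b[of "Sym s"] by (simp add: insert_Diff_if)
    show "Row r \<in> ?B t \<and> Sym s \<in> ?B t \<Longrightarrow> Col c \<in> ?B t"
      using b[of "Col c"] by (simp add: insert_Diff_if)
    show "Col c \<in> ?B t \<and> Sym s \<in> ?B t \<Longrightarrow> Row r \<in> ?B t"
      using b[of "Row r"] by (simp add: insert_Diff_if)
  qed
  then show ?thesis ..
qed

text \<open>A closed set containing \<open>M\<close> contains everything that burns. Conversely, the
  burned set becomes closed after some round, so the condition applies with that set as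
  \<open>Y\<close>.\<close>

lemma lazy_burning_set_iff:
  "lazy_burning_set (latin_hypergraph L) M \<longleftrightarrow>
     M \<subseteq> lines L \<and> (\<forall>Y. closed_lines L Y \<longrightarrow> M \<subseteq> Y \<longrightarrow> Y = lines L)"
proof -
  have "fst (latin_hypergraph L) = lines L" by (simp add: latin_hypergraph_def)
  moreover have "Y \<subseteq> lines L" if "closed_lines L Y" for Y
    using that by (simp add: closed_lines_def)
  ultimately show ?thesis
    unfolding lazy_burning_set_def
    using lazy_burned_subset_closed lazy_burned_eventually_closed lazy_burned_superset
    by (metis subset_antisym)
qed

section \<open>From connected chains to burning sets\<close>

text \<open>
  By minimality a step adds no more than the fire does: \<open>T'\<close> cut down to the lines of \<open>Y\<close> still
  competes with \<open>T'\<close>.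
\<close>
lemma chain_step_lines_burned:
  assumes T: "subsquare T L" "T \<noteq> {}" "lines T \<subseteq> Y" and Y: "closed_lines L Y"
    and l: "l \<in> Y" "l \<in> lines T'"
    and min: "is_arg_min card (\<lambda>U. subsquare U L \<and> l \<in> lines U \<and> T \<subseteq> U) T'"
  shows "lines T' \<subseteq> Y"
proof -
  let ?U = "entries_in L (lines T' \<inter> Y)"
  have T': "subsquare T' L" "T \<subseteq> T'"
    using min by (auto simp: is_arg_min_def)
  have X: "closed_lines L (lines T' \<inter> Y)"
    using closed_lines_Int subsquare_closed_lines T'(1) Y by blast
  have "T = entries_in L (lines T)"
    using entries_in_lines_subsquare T(1) by simp
  also have "\<dots> \<subseteq> ?U"
    using lines_mono[OF T'(2)] T(3) unfolding entries_in_def by blast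
  finally have TU: "T \<subseteq> ?U" .
  \<comment> \<open>As \<open>T\<close> is nonempty, \<open>?U\<close> has the entry that
    \<open>closed_lines_subsquare\<close> asks for.\<close>
  then have U: "subsquare ?U L" "lines ?U = lines T' \<inter> Y"
    using closed_lines_subsquare[OF X] T(2) by auto
  have "?U \<subseteq> entries_in L (lines T')"
    by (auto simp: entries_in_def)
  then have UT': "?U \<subseteq> T'"
    using entries_in_lines_subsquare T'(1) by simp
  have "card T' \<le> card ?U"
    using min U l TU unfolding is_arg_min_linorder by blast
  moreover have "finite T'"
    using T'(1) finite_square by (auto simp: subsquare_def intro: rev_finite_subset)
  ultimately have "?U = T'"
    using UT' by (meson card_seteq)
  then show ?thesis using U(2) by auto
qed

text \<open>Two lines of the entry in \<open>S 1\<close> and one new line for each of the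
  \<open>a - 1\<close> later steps burn the members of the chain one after another.\<close>

lemma burning_set_of_connected_chain:
  assumes "connected_chain L S a"
  shows "\<exists>M. finite M \<and> lazy_burning_set (latin_hypergraph L) M \<and> card M \<le> a + 1"
proof -
  have S: "1 \<le> a" "S a = L" "\<And>i. i < a \<Longrightarrow> chain_step L (S i) (S (Suc i))"
    using assms by (auto simp: connected_chain_iff)
  obtain r c s where S1: "S 1 = {(r, c, s)}"
    using assms by (auto simp: connected_chain_iff)
  let ?Q = "\<lambda>i l. l \<in> lines L \<and> l \<in> lines (S (Suc i)) \<and>
      is_arg_min card (\<lambda>U. subsquare U L \<and> l \<in> lines U \<and> S i \<subseteq> U) (S (Suc i))"
  have "\<forall>i\<in>{..<a}. \<exists>l. ?Q i l"
    using S(3) unfolding chain_step_def lessThan_iff Ball_def by blast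
  from bchoice[OF this] obtain f where f: "\<And>i. i < a \<Longrightarrow> ?Q i (f i)"
    by (auto simp only: lessThan_iff Ball_def)
  \<comment> \<open>The index \<open>i\<close> belongs to the step from \<open>S i\<close> to
    \<open>S (Suc i)\<close>. It starts at 1 because \<open>Row r\<close> and \<open>Col c\<close>
    already account for the step from the empty set.\<close>
  define M where "M = {Row r, Col c} \<union> f ` {1..<a}"
  have sub: "subsquare (S i) L" if "1 \<le> i" "i \<le> a" for i
    using that chain_stepD(1)[OF S(3)[of "i - 1"]] by simp
  have e: "(r, c, s) \<in> L"
    using sub[of 1] S(1) S1 by (auto simp: subsquare_def)
  have sub_M: "M \<subseteq> lines L"
    using f e by (auto simp: M_def entry_lines)
  have "Y = lines L" if Y: "closed_lines L Y" "M \<subseteq> Y" for Y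
  proof -
    \<comment> \<open>Nonemptiness is carried through the induction because
      \<open>chain_step_lines_burned\<close> requires it of the source of a step.\<close>
    have "lines (S i) \<subseteq> Y \<and> S i \<noteq> {}" if "1 \<le> i" "i \<le> a" for i
      using that
    proof (induction i rule: dec_induct)
      case base
      have "Row r \<in> Y" "Col c \<in> Y"
        using Y(2) by (auto simp: M_def)
      moreover from this have "Sym s \<in> Y"
        using Y(1) e unfolding closed_lines_def by blast
      ultimately show ?case
        unfolding S1 lines_singleton by simp
    next
      case (step i)
      have "lines (S (Suc i)) \<subseteq> Y"
      proof (rule chain_step_lines_burned)
        show "subsquare (S i) L" using sub step by simp
        show "S i \<noteq> {}" "lines (S i) \<subseteq> Y" using step by simp_all
        show "closed_lines L Y" by fact
        have "f i \<in> M" using step by (simp add: M_def)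
        then show "f i \<in> Y" using Y(2) by blast
      qed (use f[of i] step in simp_all)
      moreover have "S (Suc i) \<noteq> {}"
        using step chain_stepD(2)[OF S(3)[of i]] by auto
      ultimately show ?case ..
    qed
    from this[of a] show ?thesis
      using S(1,2) Y(1) by (auto simp: closed_lines_def)
  qed
  then have "lazy_burning_set (latin_hypergraph L) M"
    using sub_M by (simp add: lazy_burning_set_iff)
  moreover have "card M \<le> a + 1"
  proof -
    have "card M \<le> card {Row r, Col c :: ('r, 'c, 's) line} + card (f ` {1..<a})"
      unfolding M_def by (rule card_Un_le)
    also have "\<dots> \<le> 2 + (a - 1)"
      using card_image_le[of "{1..<a}" f] by auto
    finally show ?thesis using S(1) by simp
  qed
  moreover have "finite M" by (simp add: M_def)
  ultimately show ?thesis by blast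
qed

section \<open>From burning sets to connected chains\<close>

text \<open>Each line of \<open>F\<close> costs at most one step: it is skipped if the current
  subsquare already meets it, and otherwise the next subsquare is a smallest one through it. The
  last assumption says that \<open>lines T\<close> and \<open>F\<close> together burn
  everything.\<close>

lemma chain_steps_from_lines:
  assumes "finite F" and "F \<subseteq> lines L" and "subsquare T L"
    and "\<And>Y. closed_lines L Y \<Longrightarrow> lines T \<union> F \<subseteq> Y \<Longrightarrow> Y = lines L"
  shows "\<exists>j\<le>card F. (chain_step L ^^ j) T L"
  using assms
proof (induction F arbitrary: T rule: finite_induct)
  case empty
  \<comment> \<open>With no line left, \<open>lines T\<close> is itself a closed set as in the last
    assumption.\<close>
  then have "lines T = lines L"
    using subsquare_closed_lines by simp
  then have "T = L"
    using subsquare_eq_if_lines_eq empty subsquare_self by blast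
  then show ?case by simp
next
  case (insert m F)
  show ?case
  proof (cases "m \<in> lines T")
    case True
    then have "\<exists>j\<le>card F. (chain_step L ^^ j) T L"
      using insert.prems by (intro insert.IH) auto
    then show ?thesis
      using insert.hyps by (auto intro: le_SucI)
  next
    case False
    then obtain T' where T': "chain_step L T T'" "subsquare T' L" "T \<subseteq> T'" "m \<in> lines T'"
      using chain_step_exists insert.prems by (metis insert_subset)
    have "\<exists>j\<le>card F. (chain_step L ^^ j) T' L"
    proof (rule insert.IH)
      show "F \<subseteq> lines L" "subsquare T' L"
        using insert.prems T' by simp_all
      \<comment> \<open>A closed set containing \<open>lines T'\<close> contains
        \<open>lines T\<close> and \<open>m\<close>, so burning everything is preserved by the
        step.\<close>
      show "Y = lines L" if "closed_lines L Y" "lines T' \<union> F \<subseteq> Y" for Y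
        using that T'(4) lines_mono[OF T'(3)] by (intro insert.prems(3)) auto
    qed
    then obtain j where "j \<le> card F" "(chain_step L ^^ Suc j) T L"
      using T'(1) relpowp_Suc_I2 by metis
    then show ?thesis
      using insert.hyps by (intro exI[of _ "Suc j"]) simp
  qed
qed

text \<open>If \<open>M\<close> had lines of one kind only, it would be closed and hence equal to
  \<open>lines L\<close>, which has both a row and a column. Two lines of different kinds always
  share an entry of \<open>L\<close>.\<close>

lemma burning_set_two_lines_of_entry:
  assumes "L \<noteq> {}" and "lazy_burning_set (latin_hypergraph L) M"
  obtains r c s a b where "(r, c, s) \<in> L" "a \<in> M" "b \<in> M" "a \<noteq> b" "{a, b} \<subseteq> {Row r, Col c, Sym s}"
proof -
  have M: "M \<subseteq> lines L" "\<And>Y. closed_lines L Y \<Longrightarrow> M \<subseteq> Y \<Longrightarrow> Y = lines L"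
    using assms(2) by (auto simp: lazy_burning_set_iff)
  obtain r0 c0 s0 where e: "(r0, c0, s0) \<in> L" using assms(1) by auto
  have "\<not> (M \<subseteq> range Row \<or> M \<subseteq> range Col \<or> M \<subseteq> range Sym)"
  proof
    assume kind: "M \<subseteq> range Row \<or> M \<subseteq> range Col \<or> M \<subseteq> range Sym"
    then have "M = lines L"
      using M closed_lines_one_kind by blast
    then have "Row r0 \<in> M" "Col c0 \<in> M"
      using entry_lines[OF e] by simp_all
    with kind show False by blast
  qed
  then have "(\<exists>r c. Row r \<in> M \<and> Col c \<in> M) \<or> (\<exists>r s. Row r \<in> M \<and> Sym s \<in> M) \<or>
      (\<exists>c s. Col c \<in> M \<and> Sym s \<in> M)"
    by (metis line.exhaust rangeI subsetI)
  then show ?thesis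
  proof (elim disjE exE conjE)
    fix r c assume *: "Row r \<in> M" "Col c \<in> M"
    then have "r \<in> row_set L" "c \<in> col_set L"
      using M(1) by (metis Row_in_lines Col_in_lines subsetD)+
    then obtain s where "(r, c, s) \<in> L" using unique_entry(1) by blast
    then show ?thesis using * by (intro that[of r c s "Row r" "Col c"]) auto
  next
    fix r s assume *: "Row r \<in> M" "Sym s \<in> M"
    then have "r \<in> row_set L" "s \<in> sym_set L"
      using M(1) by (metis Row_in_lines Sym_in_lines subsetD)+
    then obtain c where "(r, c, s) \<in> L" using unique_entry(2) by blast
    then show ?thesis using * by (intro that[of r c s "Row r" "Sym s"]) auto
  next
    fix c s assume *: "Col c \<in> M" "Sym s \<in> M"
    then have "c \<in> col_set L" "s \<in> sym_set L"
      using M(1) by (metis Col_in_lines Sym_in_lines subsetD)+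
    then obtain r where "(r, c, s) \<in> L" using unique_entry(3) by blast
    then show ?thesis using * by (intro that[of r c s "Col c" "Sym s"]) auto
  qed
qed

text \<open>The entry through \<open>a\<close> and \<open>b\<close> is the first nonempty member.
  The other \<open>card M - 2\<close> lines give at most that many steps, and the step from the
  empty set to the entry adds one.\<close>

lemma connected_chain_of_burning_set:
  assumes "L \<noteq> {}" and M: "finite M" "lazy_burning_set (latin_hypergraph L) M"
  shows "\<exists>S a. connected_chain L S a \<and> a + 1 \<le> card M"
proof -
  obtain r c s a b where e: "(r, c, s) \<in> L" and ab: "a \<in> M" "b \<in> M" "a \<noteq> b"
      "{a, b} \<subseteq> {Row r, Col c, Sym s}"
    using burning_set_two_lines_of_entry[OF assms(1) M(2)] .
  have "\<exists>j\<le>card (M - {a, b}). (chain_step L ^^ j) {(r, c, s)} L"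
  proof (rule chain_steps_from_lines)
    show "M - {a, b} \<subseteq> lines L"
      using M(2) by (auto simp: lazy_burning_set_iff)
    show "Y = lines L" if "closed_lines L Y" "lines {(r, c, s)} \<union> (M - {a, b}) \<subseteq> Y" for Y
    proof -
      have "M \<subseteq> Y" using that(2) ab(4) unfolding lines_singleton by blast
      then show ?thesis using M(2) that(1) by (simp add: lazy_burning_set_iff)
    qed
  qed (use M(1) subsquare_singleton[OF e] in simp_all)
  moreover have "card (M - {a, b}) = card M - 2"
    using M ab by (simp add: card_Diff_subset)
  moreover have "2 \<le> card M"
    using card_mono[of M "{a, b}"] M ab by simp
  ultimately obtain j where j: "j + 2 \<le> card M" "(chain_step L ^^ j) {(r, c, s)} L"
    by (auto simp: le_diff_conv2)
  then obtain f where f: "f 0 = {(r, c, s)}" "f j = L" "\<forall>i<j. chain_step L (f i) (f (Suc i))"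
    by (auto simp: relpowp_fun_conv)
  \<comment> \<open>Puts the empty set in front of \<open>f\<close>, so \<open>S (Suc i)\<close> is
    \<open>f i\<close> and the length is \<open>Suc j\<close>.\<close>
  define S where "S = case_nat {} f"
  have "chain_step L (S i) (S (Suc i))" if "i < Suc j" for i
    using that f chain_step_empty_singleton[OF e] by (cases i) (auto simp: S_def)
  then have "connected_chain L S (Suc j)"
    using f by (simp add: connected_chain_iff S_def)
  then show ?thesis using j(1) by (intro exI[of _ S] exI[of _ "Suc j"]) simp
qed

end

section \<open>Comparison of the two minima\<close>

theorem theorem3p2:
  fixes L :: "('r, 'c, 's) square" and n :: nat
  assumes "n \<ge> 1" and "latin_square n L"
  shows "lazy_burning_number (latin_hypergraph L) = scc L + 1"
proof -
  let ?H = "latin_hypergraph L"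
  let ?b = "lazy_burning_number ?H"
  have ne: "L \<noteq> {}"
    using assms unfolding latin_square_def row_set_def by force
  \<comment> \<open>Some burning set exists, so the \<open>LEAST\<close> in
    \<open>lazy_burning_number\<close> is attained.\<close>
  have "lazy_burning_set ?H (lines L)"
    unfolding lazy_burning_set_iff[OF assms(2)] closed_lines_def by blast
  then have "\<exists>k M. finite M \<and> lazy_burning_set ?H M \<and> card M = k"
    using finite_lines[OF finite_square[OF assms(2)]] by (intro exI[of _ "lines L"] exI) simp
  then have "\<exists>M. finite M \<and> lazy_burning_set ?H M \<and> card M = ?b"
    unfolding lazy_burning_number_def by (rule LeastI_ex)
  then obtain M0 where M0: "finite M0" "lazy_burning_set ?H M0" "card M0 = ?b"
    by blast
  \<comment> \<open>This chain bounds \<open>scc L\<close> from above and also shows that the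
    \<open>LEAST\<close> in \<open>scc\<close> is attained.\<close>
  obtain S a where a: "connected_chain L S a" "a + 1 \<le> ?b"
    using connected_chain_of_burning_set[OF assms(2) ne M0(1,2)] M0(3) by auto
  then have ex: "\<exists>S. connected_chain L S a" by blast
  have scc_le: "scc L \<le> a"
    unfolding scc_def using ex by (rule Least_le)
  have "\<exists>S. connected_chain L S (scc L)"
    unfolding scc_def using ex by (rule LeastI)
  then obtain S' where "connected_chain L S' (scc L)" ..
  then obtain M where M: "finite M" "lazy_burning_set ?H M" "card M \<le> scc L + 1"
    using burning_set_of_connected_chain[OF assms(2)] by blast
  then have "\<exists>M'. finite M' \<and> lazy_burning_set ?H M' \<and> card M' = card M" by blast
  then have "?b \<le> card M"
    unfolding lazy_burning_number_def by (rule Least_le)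
  then show ?thesis
    using M(3) a(2) scc_le by simp
qed

end
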